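(* If $\sigma(x)/x\in\mathbb{Z}[\zeta_p]$, then $I=x\mathcal{O}_\mathbb{K}$, i.e. $I$ is the principal ideal of $\mathcal{O}_\mathbb{K}$ generated by $x$.
   Context: Let $n>1$ be an odd integer and $p$ a prime with $p\equiv 1 \pmod n$. Let $\zeta_p=e^{2\pi i/p}$, let $r$ be a primitive root modulo $p$, and let $\sigma$ be the automorphism of $\mathbb{Q}(\zeta_p)$ with $\sigma(\zeta_p)=\zeta_p^r$. Let $\mathbb{K}=\{y\in\mathbb{Q}(\zeta_p):\sigma^n(y)=y\}$. Let $\alpha=\prod_{j=0}^{(p-3)/2}(1-\zeta_p^{r^j})$, let $\lambda$ be an integer with $\lambda(r-1)\equiv1\pmod p$, $z=\zeta_p^{\lambda}\alpha(1-\zeta_p)$, and $x=\mathrm{Tr}_{\mathbb{Q}(\zeta_p)/\mathbb{K}}(z)=\sum_{j=1}^{(p-1)/n}\sigma^{jn}(z)$. Let $I$ be the $\mathbb{Z}$-module generated by $x,\sigma(x),\dots,\sigma^{n-1}(x)$ (it is an ideal of $\mathcal{O}_\mathbb{K}$). *)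

theory Defs
  imports Complex_Main "HOL-Number_Theory.Number_Theory" "HOL-Computational_Algebra.Polynomial"
begin

definition zeta :: "nat \<Rightarrow> complex" where
  "zeta p = exp (2 * of_real pi * \<i> / of_nat p)"

definition cyc_field :: "nat \<Rightarrow> complex set" where
  "cyc_field p = {poly (map_poly of_rat f) (zeta p) | f :: rat poly. True}"

definition cyc_int_ring :: "nat \<Rightarrow> complex set" where
  "cyc_int_ring p = {poly (map_poly of_int f) (zeta p) | f :: int poly. True}"

text \<open>The automorphism sigma of Q(zeta_p) with sigma(zeta_p) = zeta_p ^ r:
  sigma(f(zeta_p)) = f(zeta_p ^ r) for rational polynomials f.\<close>
definition cyc_sigma :: "nat \<Rightarrow> nat \<Rightarrow> complex \<Rightarrow> complex" where
  "cyc_sigma p r y = (SOME w. \<exists>f :: rat poly.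
      poly (map_poly of_rat f) (zeta p) = y \<and> w = poly (map_poly of_rat f) (zeta p ^ r))"

definition algebraic_int :: "complex \<Rightarrow> bool" where
  "algebraic_int y \<longleftrightarrow> (\<exists>f :: int poly. lead_coeff f = 1 \<and> poly (map_poly of_int f) y = 0)"

definition fix_field :: "nat \<Rightarrow> nat \<Rightarrow> nat \<Rightarrow> complex set" where
  "fix_field n p r = {y \<in> cyc_field p. (cyc_sigma p r ^^ n) y = y}"

definition ring_of_integers_K :: "nat \<Rightarrow> nat \<Rightarrow> nat \<Rightarrow> complex set" where
  "ring_of_integers_K n p r = {y \<in> fix_field n p r. algebraic_int y}"

end

theory Submission
  imports Defs "Jordan_Normal_Form.Char_Poly"
begin

text \<open>
  Put \<open>\<beta> = \<zeta>\<^sup>\<lambda> \<alpha>\<close>. The product defining \<open>\<alpha>\<close> telescopes under \<open>\<sigma>\<close>, so \<open>\<sigma>(\<beta>) = -\<beta>\<close>; since \<open>n\<close> is odd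
  and \<open>(p - 1)/n\<close> is even, \<open>Tr(\<beta>) = 0\<close> and \<open>x = Tr(\<beta>(1 - \<zeta>)) = -Tr(\<beta>\<zeta>)\<close>. Hence every
  \<open>Tr(\<beta>\<zeta>\<^sup>k)\<close> is zero or \<open>\<plusminus>\<sigma>\<^sup>i(x)\<close> and lies in \<open>I\<close>. For an integer \<open>a\<close> of \<open>K\<close>, expanding
  \<open>(1 - \<zeta>)a \<in> \<int>[\<zeta>]\<close> in powers of \<open>\<zeta>\<close> gives \<open>xa = Tr(\<beta>(1 - \<zeta>)a) \<in> I\<close>. Conversely,
  \<open>\<sigma>\<^sup>i(x)/x\<close> is a product of conjugates of \<open>\<sigma>(x)/x\<close>, so it is an integer of \<open>K\<close>, whence
  \<open>I \<subseteq> x O\<^sub>K\<close>.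

  The arithmetic input is \<open>O = \<int>[\<zeta>]\<close>: if \<open>y = \<Sum> q\<^sub>k \<zeta>\<^sup>k\<close> is integral, then
  \<open>p (q\<^sub>t - q\<^sub>0) = Tr(y(\<zeta>\<^sup>-\<^sup>t - 1))\<close> is a rational multiple of the prime \<open>\<zeta> - 1\<close> above \<open>p\<close>,
  hence divisible by \<open>p\<close>.
\<close>

section \<open>Roots of unity and the ring generated by them\<close>

lemma power_mod_eq_of_power_eq_1:
  fixes w :: "'a::monoid_mult"
  assumes "w ^ p = 1"
  shows "w ^ (i mod p) = w ^ i"
proof -
  have "w ^ i = w ^ (p * (i div p) + i mod p)" by simp
  also have "\<dots> = w ^ (i mod p)" by (simp only: power_add power_mult assms power_one mult_1_left)
  finally show ?thesis by simp
qed

text \<open>Exponents are collapsed modulo \<open>p\<close>. Since \<open>c\<close> is fixed before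
  \<open>w\<close>, one expansion describes all conjugates of an element at once; the general
  \<open>h\<close> covers integer and rational coefficients alike.\<close>

lemma poly_eq_sum_lessThan_root_of_unity:
  fixes h :: "'a::comm_ring_1 \<Rightarrow> 'b::comm_ring_1"
  assumes "comm_ring_hom h" and "p > 0"
  obtains c where "\<And>w. w ^ p = 1 \<Longrightarrow> poly (map_poly h f) w = (\<Sum>k<p. h (c k) * w ^ k)"
proof -
  interpret comm_ring_hom h by fact
  define c where "c k = (\<Sum>i\<in>{i\<in>{..degree f}. i mod p = k}. coeff f i)" for k
  have "poly (map_poly h f) w = (\<Sum>k<p. h (c k) * w ^ k)" if w: "w ^ p = 1" for w
  proof -
    have "poly (map_poly h f) w = (\<Sum>i\<le>degree f. h (coeff f i) * w ^ i)"
    proof -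
      have "poly (map_poly h f) w = (\<Sum>i\<le>degree f. coeff (map_poly h f) i * w ^ i)"
        unfolding poly_altdef
        by (rule sum.mono_neutral_left) (auto simp: coeff_map_poly degree_map_poly_le intro!: le_degree)
      thus ?thesis by (simp add: coeff_map_poly)
    qed
    also have "\<dots> = (\<Sum>k<p. \<Sum>i\<in>{i\<in>{..degree f}. i mod p = k}. h (coeff f i) * w ^ i)"
      using \<open>p > 0\<close> by (intro sum.group[symmetric]) auto
    also have "\<dots> = (\<Sum>k<p. h (c k) * w ^ k)"
      unfolding c_def hom_sum sum_distrib_right
      by (intro sum.cong refl) (auto simp: power_mod_eq_of_power_eq_1[OF w])
    finally show ?thesis .
  qed
  thus ?thesis by (rule that)
qed

lemma zeta_power_eq_cis: "zeta p ^ k = cis (2 * pi * real k / real p)"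
proof -
  have "zeta p = cis (2 * pi / real p)"
    by (simp add: zeta_def cis_conv_exp mult_ac)
  thus ?thesis by (simp add: DeMoivre mult_ac)
qed

lemma zeta_power_self [simp]: "p > 0 \<Longrightarrow> zeta p ^ p = 1"
  by (simp add: zeta_power_eq_cis)

lemma zeta_power_power_self [simp]: "p > 0 \<Longrightarrow> (zeta p ^ k) ^ p = 1"
  by (metis mult.commute power_mult power_one zeta_power_self)

lemma zeta_neq_0 [simp]: "zeta p \<noteq> 0"
  by (simp add: zeta_def)

lemma zeta_power_eq_1_iff:
  assumes "p > 0"
  shows "zeta p ^ k = 1 \<longleftrightarrow> p dvd k"
proof -
  have "zeta p ^ k = 1 \<longleftrightarrow> zeta p ^ (k mod p) = zeta p ^ 0"
    using assms by (simp add: power_mod_eq_of_power_eq_1)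
  also have "\<dots> \<longleftrightarrow> k mod p = 0"
    using bij_betw_roots_unity[OF assms] assms
    unfolding zeta_power_eq_cis bij_betw_def inj_on_def by force
  finally show ?thesis by (simp add: mod_eq_0_iff_dvd)
qed

lemma zeta_power_cong:
  assumes "p > 0" "[a = b] (mod p)"
  shows "zeta p ^ a = zeta p ^ b"
  using assms power_mod_eq_of_power_eq_1[OF zeta_power_self[OF assms(1)]]
  by (metis cong_def)

text \<open>Orthogonality of characters, by a geometric series; it later extracts single
  coefficients from traces.\<close>

lemma sum_zeta_powers:
  assumes "p > 0"
  shows "(\<Sum>j<p. zeta p ^ (j * k)) = (if p dvd k then of_nat p else 0)"
proof (cases "p dvd k")
  case True
  have "zeta p ^ (j * k) = 1" for j
    using True by (simp add: zeta_power_eq_1_iff[OF assms])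
  thus ?thesis using True by simp
next
  case False
  hence "zeta p ^ k \<noteq> 1" by (simp add: zeta_power_eq_1_iff[OF assms])
  hence "(\<Sum>j<p. (zeta p ^ k) ^ j) = 0"
    using assms by (simp add: geometric_sum)
  thus ?thesis using False by (simp add: power_mult[symmetric] mult.commute)
qed

section \<open>The ring Z[zeta]: closure properties and integrality\<close>

lemma cyc_int_ringI: "poly (map_poly of_int f) (zeta p) \<in> cyc_int_ring p"
  by (auto simp: cyc_int_ring_def)

lemma of_int_in_cyc_int_ring [simp]: "of_int a \<in> cyc_int_ring p"
  using cyc_int_ringI[of "[:a:]" p] by (simp add: of_int_hom.map_poly_pCons_hom)

lemma zero_in_cyc_int_ring [simp]: "0 \<in> cyc_int_ring p"
  using of_int_in_cyc_int_ring[of 0] by simp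

lemma one_in_cyc_int_ring [simp]: "1 \<in> cyc_int_ring p"
  using of_int_in_cyc_int_ring[of 1] by simp

lemma of_nat_in_cyc_int_ring [simp]: "of_nat a \<in> cyc_int_ring p"
  using of_int_in_cyc_int_ring[of "int a"] by simp

lemma zeta_in_cyc_int_ring [simp]: "zeta p \<in> cyc_int_ring p"
  using cyc_int_ringI[of "[:0, 1:]" p] by simp

lemma cyc_int_ring_add [intro]:
  "\<lbrakk>u \<in> cyc_int_ring p; v \<in> cyc_int_ring p\<rbrakk> \<Longrightarrow> u + v \<in> cyc_int_ring p"
  by (auto simp: cyc_int_ring_def) (metis of_int_poly_hom.hom_add poly_add)

lemma cyc_int_ring_mult [intro]:
  "\<lbrakk>u \<in> cyc_int_ring p; v \<in> cyc_int_ring p\<rbrakk> \<Longrightarrow> u * v \<in> cyc_int_ring p"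
  by (auto simp: cyc_int_ring_def) (metis of_int_poly_hom.hom_mult poly_mult)

lemma cyc_int_ring_minus [intro]: "u \<in> cyc_int_ring p \<Longrightarrow> - u \<in> cyc_int_ring p"
  using cyc_int_ring_mult[of "-1" p u] of_int_in_cyc_int_ring[of "-1" p] by simp

lemma cyc_int_ring_diff [intro]:
  "\<lbrakk>u \<in> cyc_int_ring p; v \<in> cyc_int_ring p\<rbrakk> \<Longrightarrow> u - v \<in> cyc_int_ring p"
  using cyc_int_ring_add[of u p "-v"] cyc_int_ring_minus by simp

lemma cyc_int_ring_power [intro]: "u \<in> cyc_int_ring p \<Longrightarrow> u ^ k \<in> cyc_int_ring p"
  by (induction k) auto

lemma cyc_int_ring_sum [intro]:
  "(\<And>i. i \<in> S \<Longrightarrow> g i \<in> cyc_int_ring p) \<Longrightarrow> (\<Sum>i\<in>S. g i) \<in> cyc_int_ring p"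
  by (induction S rule: infinite_finite_induct) auto

lemma cyc_int_ring_prod [intro]:
  "(\<And>i. i \<in> S \<Longrightarrow> g i \<in> cyc_int_ring p) \<Longrightarrow> (\<Prod>i\<in>S. g i) \<in> cyc_int_ring p"
  by (induction S rule: infinite_finite_induct) auto

lemma poly_of_int_in_cyc_int_ring:
  "w \<in> cyc_int_ring p \<Longrightarrow> poly (map_poly of_int f) w \<in> cyc_int_ring p"
  by (induction f) auto

lemma cyc_int_ringE:
  assumes "u \<in> cyc_int_ring p" "p > 0"
  obtains c :: "nat \<Rightarrow> int" where "u = (\<Sum>k<p. of_int (c k) * zeta p ^ k)"
proof -
  obtain f where f: "u = poly (map_poly of_int f) (zeta p)"
    using assms(1) by (auto simp: cyc_int_ring_def)
  obtain c :: "nat \<Rightarrow> int" where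
    "\<And>w :: complex. w ^ p = 1 \<Longrightarrow> poly (map_poly of_int f) w = (\<Sum>k<p. of_int (c k) * w ^ k)"
    using poly_eq_sum_lessThan_root_of_unity[OF of_int_hom.comm_ring_hom_axioms assms(2)] by metis
  thus ?thesis using that f assms(2) by simp
qed

text \<open>The element \<open>u = \<Sum> c\<^sub>k \<zeta>\<^sup>k\<close> is an eigenvalue of the circulant matrix of its coefficients,
  with eigenvector \<open>(1, \<zeta>, \<zeta>\<^sup>2, \<dots>)\<close>.\<close>
lemma algebraic_int_if_in_cyc_int_ring:
  assumes "u \<in> cyc_int_ring p" "p > 0"
  shows "algebraic_int u"
proof -
  obtain c where u: "u = (\<Sum>k<p. of_int (c k) * zeta p ^ k)"
    using cyc_int_ringE[OF assms] .
  \<comment> \<open>Multiplication by \<open>u\<close> sends \<open>zeta p ^ i\<close> to the sum of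
    the \<open>c k * zeta p ^ (i + k)\<close>, so entry \<open>(i, j)\<close> is the coefficient
    with index \<open>j - i\<close> modulo \<open>p\<close>; adding \<open>p - i\<close> avoids
    truncated subtraction.\<close>
  define M where "M = mat p p (\<lambda>(i, j). c ((j + (p - i)) mod p))"
  define M' :: "complex mat" where "M' = map_mat of_int M"
  define v where "v = vec p (\<lambda>j. zeta p ^ j)"
  have M: "M \<in> carrier_mat p p" by (simp add: M_def)
  have M': "M' \<in> carrier_mat p p" by (simp add: M'_def M_def)
  have "M' *\<^sub>v v = u \<cdot>\<^sub>v v"
  proof (rule eq_vecI)
    show "dim_vec (M' *\<^sub>v v) = dim_vec (u \<cdot>\<^sub>v v)" using M' by (simp add: v_def)
  next
    fix i assume "i < dim_vec (u \<cdot>\<^sub>v v)"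
    hence i: "i < p" by (simp add: v_def)
    have "(M' *\<^sub>v v) $ i = (\<Sum>j<p. of_int (c ((j + (p - i)) mod p)) * zeta p ^ j)"
      using i M' by (simp add: M'_def M_def v_def scalar_prod_def lessThan_atLeast0)
    also have "\<dots> = (\<Sum>k<p. of_int (c k) * zeta p ^ (i + k))"
    proof (rule sum.reindex_bij_witness[of _ "\<lambda>k. (i + k) mod p" "\<lambda>j. (j + (p - i)) mod p"])
      fix j assume j: "j \<in> {..<p}"
      show "(i + (j + (p - i)) mod p) mod p = j"
        using i j by (simp add: mod_simps)
      show "(j + (p - i)) mod p \<in> {..<p}" using assms by simp
      have "[i + (j + (p - i)) mod p = j] (mod p)"
        using i j by (simp add: cong_def mod_simps)
      from zeta_power_cong[OF assms(2) this]
      show "of_int (c ((j + (p - i)) mod p)) * zeta p ^ (i + (j + (p - i)) mod p) =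
            of_int (c ((j + (p - i)) mod p)) * zeta p ^ j" by simp
    next
      fix k assume k: "k \<in> {..<p}"
      have "(((i + k) mod p) + (p - i)) mod p = (i + k + (p - i)) mod p" by (simp add: mod_simps)
      also have "i + k + (p - i) = k + p" using i by simp
      finally show "(((i + k) mod p) + (p - i)) mod p = k" using k by simp
      show "(i + k) mod p \<in> {..<p}" using assms by simp
    qed
    also have "\<dots> = u * zeta p ^ i"
      unfolding u sum_distrib_right by (intro sum.cong) (auto simp: power_add)
    also have "\<dots> = (u \<cdot>\<^sub>v v) $ i" using i by (simp add: v_def)
    finally show "(M' *\<^sub>v v) $ i = (u \<cdot>\<^sub>v v) $ i" .
  qed
  moreover have "v \<noteq> 0\<^sub>v p"
  proof
    assume "v = 0\<^sub>v p"
    hence "v $ 0 = 0" using assms by simp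
    thus False using assms by (simp add: v_def)
  qed
  ultimately have "eigenvalue M' u"
    using M' unfolding eigenvalue_def eigenvector_def by (intro exI[of _ v]) (auto simp: v_def)
  hence "poly (char_poly M') u = 0" using eigenvalue_root_char_poly[OF M'] by simp
  moreover have "char_poly M' = map_poly of_int (char_poly M)"
    unfolding M'_def by (rule of_int_hom.char_poly_hom[OF M])
  ultimately show ?thesis
    unfolding algebraic_int_def
    using degree_monic_char_poly[OF M] by (intro exI[of _ "char_poly M"]) auto
qed

lemma rational_in_cyc_int_ring_is_int:
  assumes "u \<in> cyc_int_ring p" "u \<in> \<rat>" "p > 0"
  shows "u \<in> \<int>"
proof -
  \<comment> \<open>The qualified name is the library notion of algebraic integer, for which the
    rational root theorem is available.\<close>
  have "Polynomial.algebraic_int u"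
    using algebraic_int_if_in_cyc_int_ring[OF assms(1,3)]
    by (auto simp: algebraic_int_def algebraic_int_altdef_ipoly)
  thus ?thesis using assms(2) by (rule rational_algebraic_int_is_int)
qed

text \<open>Elements whose powers have a common denominator. Unlike for roots of monic polynomials,
  closure under sums and products is immediate, and for rational numbers the condition still
  forces integrality.\<close>
definition almost_int :: "nat \<Rightarrow> complex set" where
  "almost_int p = {w. \<exists>D::int. D > 0 \<and> (\<forall>m. of_int D * w ^ m \<in> cyc_int_ring p)}"

lemma cyc_int_ring_subset_almost_int: "u \<in> cyc_int_ring p \<Longrightarrow> u \<in> almost_int p"
  unfolding almost_int_def by (auto intro!: exI[of _ "1::int"])

lemma almost_int_mult:
  assumes "x \<in> almost_int p" "y \<in> almost_int p"
  shows "x * y \<in> almost_int p"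
proof -
  obtain D E :: int where D: "D > 0" "\<And>m. of_int D * x ^ m \<in> cyc_int_ring p"
    and E: "E > 0" "\<And>m. of_int E * y ^ m \<in> cyc_int_ring p"
    using assms by (auto simp: almost_int_def)
  have "of_int (D * E) * (x * y) ^ m \<in> cyc_int_ring p" for m
    using cyc_int_ring_mult[OF D(2)[of m] E(2)[of m]]
    by (simp add: power_mult_distrib mult_ac)
  thus ?thesis using D(1) E(1) unfolding almost_int_def by (auto intro!: exI[of _ "D * E"])
qed

lemma almost_int_add:
  assumes "x \<in> almost_int p" "y \<in> almost_int p"
  shows "x + y \<in> almost_int p"
proof -
  obtain D E :: int where D: "D > 0" "\<And>m. of_int D * x ^ m \<in> cyc_int_ring p"
    and E: "E > 0" "\<And>m. of_int E * y ^ m \<in> cyc_int_ring p"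
    using assms by (auto simp: almost_int_def)
  have "of_int (D * E) * (x + y) ^ m \<in> cyc_int_ring p" for m
  proof -
    have "of_int (D * E) * (x + y) ^ m =
      (\<Sum>k\<le>m. of_nat (m choose k) * ((of_int D * x ^ k) * (of_int E * y ^ (m - k))))"
      by (simp add: binomial_ring sum_distrib_left mult_ac)
    also have "\<dots> \<in> cyc_int_ring p"
      by (intro cyc_int_ring_sum cyc_int_ring_mult D E of_nat_in_cyc_int_ring)
    finally show ?thesis .
  qed
  thus ?thesis using D(1) E(1) unfolding almost_int_def by (auto intro!: exI[of _ "D * E"])
qed

lemma almost_int_sum:
  "(\<And>i. i \<in> S \<Longrightarrow> g i \<in> almost_int p) \<Longrightarrow> (\<Sum>i\<in>S. g i) \<in> almost_int p"
  by (induction S rule: infinite_finite_induct)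
     (auto intro: almost_int_add simp: cyc_int_ring_subset_almost_int)

lemma almost_int_power: "u \<in> almost_int p \<Longrightarrow> u ^ k \<in> almost_int p"
  by (induction k) (auto intro: almost_int_mult cyc_int_ring_subset_almost_int)

text \<open>For \<open>q = a / b\<close> in lowest terms, a single denominator \<open>D\<close> for
  all powers forces \<open>b ^ m\<close> to divide \<open>D\<close> for every \<open>m\<close>,
  which leaves only \<open>b = 1\<close>.\<close>

lemma rational_almost_int_is_int:
  assumes "q \<in> almost_int p" "q \<in> \<rat>" "p > 0"
  shows "q \<in> \<int>"
proof -
  obtain D :: int where D: "D > 0" "\<And>m. of_int D * q ^ m \<in> cyc_int_ring p"
    using assms by (auto simp: almost_int_def)
  obtain a b where ab: "b > 0" "coprime a b" and q: "q = of_int a / of_int b"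
    using assms(2) by (auto elim: Rats_cases')
  \<comment> \<open>An exponent with \<open>D < 2 ^ m\<close>, so that \<open>b \<ge> 2\<close>
    contradicts \<open>b ^ m \<le> D\<close>.\<close>
  define m where "m = nat D"
  have "of_int D * q ^ m \<in> \<int>"
    using D(2) assms by (intro rational_in_cyc_int_ring_is_int[of _ p]) auto
  then obtain N where "of_int D * q ^ m = of_int N" by (auto elim: Ints_cases)
  hence "(of_int (D * a ^ m) :: complex) = of_int (N * b ^ m)"
    using ab(1) by (simp add: q field_simps)
  hence "D * a ^ m = N * b ^ m" by (simp only: of_int_eq_iff)
  hence "b ^ m dvd D * a ^ m" by simp
  moreover have "coprime (b ^ m) (a ^ m)" using ab(2) by (simp add: coprime_commute)
  ultimately have "b ^ m dvd D" by (simp add: coprime_dvd_mult_left_iff)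
  hence le: "b ^ m \<le> D" using D(1) by (simp add: zdvd_imp_le)
  have "b < 2"
  proof (rule ccontr)
    assume "\<not> b < 2"
    hence "2 ^ m \<le> b ^ m" by (intro power_mono) auto
    moreover have "D < 2 ^ m" using D(1) of_nat_less_two_power[of m, where ?'a = int] by (simp add: m_def)
    ultimately show False using le by linarith
  qed
  hence "b = 1" using ab(1) by simp
  thus ?thesis using q by simp
qed

section \<open>Irreducibility of the cyclotomic polynomial\<close>

text \<open>Frobenius modulo \<open>p\<close>: the inner binomial coefficients are divisible by
  \<open>p\<close>. The error term is explicit, so the identity works in a polynomial ring without
  passing to a quotient.\<close>

lemma add_power_prime:
  fixes a b :: "'a::comm_semiring_1"
  assumes "prime p"
  obtains h where "(a + b) ^ p = a ^ p + b ^ p + of_nat p * h"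
proof -
  have p: "p > 0" using assms by (simp add: prime_gt_0_nat)
  let ?t = "\<lambda>k. of_nat (p choose k) * a ^ k * b ^ (p - k)"
  define h where "h = (\<Sum>k\<in>{0<..<p}. of_nat ((p choose k) div p) * a ^ k * b ^ (p - k))"
  have "(a + b) ^ p = (\<Sum>k\<le>p. ?t k)" by (rule binomial_ring)
  also have "{..p} = insert 0 (insert p {0<..<p})" using p by auto
  also have "(\<Sum>k\<in>\<dots>. ?t k) = ?t 0 + (?t p + (\<Sum>k\<in>{0<..<p}. ?t k))" using p by simp
  also have "(\<Sum>k\<in>{0<..<p}. ?t k) = of_nat p * h"
    unfolding h_def sum_distrib_left
  proof (intro sum.cong refl)
    fix k assume k: "k \<in> {0<..<p}"
    hence "p dvd (p choose k)" using assms by (intro dvd_choose_prime) auto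
    hence "(of_nat (p choose k) :: 'a) = of_nat p * of_nat ((p choose k) div p)"
      by (simp flip: of_nat_mult)
    thus "?t k = of_nat p * (of_nat ((p choose k) div p) * a ^ k * b ^ (p - k))"
      by (simp add: mult.assoc)
  qed
  finally have "(a + b) ^ p = a ^ p + b ^ p + of_nat p * h" by (simp add: ac_simps)
  thus ?thesis by (rule that)
qed

lemma rat_poly_clear_denominator:
  fixes f :: "rat poly"
  obtains D :: int and F where "D > 0" "smult (of_int D) f = map_poly of_int F"
proof -
  have "\<exists>D F. (D::int) > 0 \<and> smult (of_int D) f = map_poly of_int F"
  proof (induction f)
    case 0
    show ?case by (intro exI[of _ 1] exI[of _ 0]) auto
  next
    case (pCons a f)
    then obtain D F where D: "(D::int) > 0" "smult (of_int D) f = map_poly of_int F" by auto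
    obtain u v where uv: "v > 0" "a = of_int u / of_int v"
      by (metis quotient_of_denom_pos' quotient_of_div surj_pair snd_conv)
    have "smult (of_int (D * v)) (pCons a f) = pCons (of_int (D * u)) (smult (of_int v) (smult (of_int D) f))"
      using uv by (simp add: mult.commute)
    also have "\<dots> = map_poly of_int (pCons (D * u) (smult v F))"
      by (simp only: D(2) of_int_hom.map_poly_pCons_hom of_int_hom.map_poly_hom_smult)
    finally show ?case using D(1) uv(1) by (intro exI[of _ "D * v"] exI) auto
  qed
  thus ?thesis using that by blast
qed

locale odd_prime_cyclotomic =
  fixes p :: nat
  assumes prime_p: "prime p" and p_gt_2: "p > 2"
begin

lemma p_pos: "p > 0" and p_gt_1: "p > 1"
  using p_gt_2 by auto

lemma odd_p: "odd p"
  using prime_p p_gt_2 prime_odd_nat by blast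

text \<open>Taken over the integers because it is monic: pseudo-division by it is genuine division
  with remainder.\<close>

definition cyclotomic :: "int poly" where
  "cyclotomic = (\<Sum>k<p. monom 1 k)"

lemma coeff_cyclotomic: "coeff cyclotomic i = (if i < p then 1 else 0)"
  by (simp add: cyclotomic_def coeff_sum)

lemma degree_cyclotomic: "degree cyclotomic = p - 1"
  using p_gt_1 by (intro antisym degree_le le_degree) (auto simp: coeff_cyclotomic)

lemma lead_coeff_cyclotomic: "lead_coeff cyclotomic = 1"
  using p_gt_1 by (simp add: degree_cyclotomic coeff_cyclotomic)

lemma cyclotomic_neq_0: "cyclotomic \<noteq> 0"
  using lead_coeff_cyclotomic by force

lemma poly_cyclotomic: "poly (map_poly of_int cyclotomic) w = (\<Sum>k<p. (w::'a::comm_ring_1) ^ k)"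
  by (simp add: cyclotomic_def of_int_poly_hom.hom_sum poly_sum poly_monom)

lemma poly_cyclotomic_1: "poly cyclotomic 1 = int p"
  by (simp add: cyclotomic_def poly_sum poly_monom)

lemma cyclotomic_mult: "[:-1, 1:] * cyclotomic = monom 1 p - 1"
proof (rule poly_eqI)
  fix n
  have "coeff (pCons 0 cyclotomic) n = (if n \<noteq> 0 \<and> n \<le> p then 1 else 0)"
    by (cases n) (auto simp: coeff_cyclotomic)
  moreover have "[:-1, 1:] * cyclotomic = pCons 0 cyclotomic - cyclotomic" by simp
  ultimately show "coeff ([:-1, 1:] * cyclotomic) n = coeff (monom 1 p - 1) n"
    using p_gt_1 by (auto simp: coeff_cyclotomic)
qed

lemma poly_cyclotomic_zeta_power:
  assumes "\<not> p dvd j"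
  shows "poly (map_poly of_int cyclotomic) (zeta p ^ j) = 0"
  using sum_zeta_powers[OF p_pos, of j] assms
  by (simp add: poly_cyclotomic power_mult[symmetric] mult.commute)

lemma zeta_neq_1: "zeta p \<noteq> 1"
  using zeta_power_eq_1_iff[OF p_pos, of 1] p_gt_1 by simp

text \<open>Frobenius turns \<open>(X - 1) ^ p\<close> into \<open>X ^ p - 1\<close> modulo
  \<open>p\<close>, which factors by \<open>cyclotomic_mult\<close>. Evaluated at
  \<open>zeta p\<close>, this says that \<open>p\<close> divides \<open>(zeta p - 1) ^ p\<close> in
  Z[zeta].\<close>

lemma linear_power_mod_cyclotomic:
  obtains h where "[:-1, 1:] ^ p = [:-1, 1:] * cyclotomic + smult (int p) h"
proof -
  obtain h :: "int poly" where
    "([:0, 1:] + [:-1:]) ^ p = [:0, 1:] ^ p + [:-1:] ^ p + of_nat p * h"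
    using add_power_prime[OF prime_p] by metis
  moreover have "[:-1:] ^ p = (-1 :: int poly)"
    using odd_p by (simp add: poly_const_pow one_pCons)
  moreover have "[:0, 1:] ^ p = (monom 1 p :: int poly)"
    by (simp add: monom_altdef)
  ultimately show ?thesis
    using that[of h] unfolding cyclotomic_mult by (simp add: of_nat_poly)
qed

text \<open>Since \<open>p\<close> divides \<open>(\<zeta> - 1)\<^sup>p\<close>, it divides \<open>T\<^sup>p\<close> for every rational multiple \<open>T\<close> of \<open>\<zeta> - 1\<close>.\<close>
lemma rational_multiple_of_zeta_minus_1:
  assumes "T \<in> \<rat>" "T = (zeta p - 1) * \<gamma>" "\<gamma> \<in> almost_int p"
  obtains t :: int where "T = of_int (int p * t)"
proof -
  have "T \<in> almost_int p"
    unfolding assms(2) by (intro almost_int_mult cyc_int_ring_subset_almost_int assms(3)) auto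
  hence "T \<in> \<int>" using assms(1) p_pos by (rule rational_almost_int_is_int)
  then obtain N where N: "T = of_int N" by (auto elim: Ints_cases)
  obtain h where h: "[:-1, 1:] ^ p = [:-1, 1:] * cyclotomic + smult (int p) h"
    by (rule linear_power_mod_cyclotomic)
  define w where "w = poly (map_poly of_int h) (zeta p)"
  have "poly (map_poly of_int ([:-1, 1:] ^ p)) (zeta p) = of_nat p * w"
    unfolding h using poly_cyclotomic_zeta_power[of 1] p_gt_1
    by (simp add: w_def hom_distribs)
  hence w: "(zeta p - 1) ^ p = of_nat p * w"
    by (simp add: hom_distribs)
  have "of_int (N ^ p) = of_nat p * (w * \<gamma> ^ p)"
    using arg_cong[OF assms(2), of "\<lambda>x. x ^ p"] N by (simp add: power_mult_distrib w)
  hence eq: "w * \<gamma> ^ p = of_int (N ^ p) / of_nat p" using p_pos by (simp add: field_simps)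
  \<comment> \<open>The quotient of \<open>N ^ p\<close> by \<open>p\<close> is rational and almost
    integral, hence an integer; primality then passes divisibility from \<open>N ^ p\<close> to
    \<open>N\<close>.\<close>
  have "w * \<gamma> ^ p \<in> almost_int p"
    unfolding w_def
    by (intro almost_int_mult almost_int_power assms(3) cyc_int_ring_subset_almost_int cyc_int_ringI)
  moreover have "w * \<gamma> ^ p \<in> \<rat>" unfolding eq by auto
  ultimately have "w * \<gamma> ^ p \<in> \<int>" using p_pos by (blast intro: rational_almost_int_is_int)
  then obtain M where "w * \<gamma> ^ p = of_int M" by (auto elim: Ints_cases)
  hence "(of_int (N ^ p) :: complex) = of_int (int p * M)"
    using eq p_pos by (simp add: field_simps)
  hence "N ^ p = int p * M" by (simp only: of_int_eq_iff)
  hence "int p dvd N ^ p" by simp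
  hence "int p dvd N" using prime_p by (metis prime_dvd_power prime_nat_int_transfer)
  thus ?thesis using that N by (elim dvdE) auto
qed

text \<open>As \<open>f\<close> vanishes at \<open>zeta p\<close>, the integer \<open>f(1)\<close>
  is a multiple of \<open>zeta p - 1\<close> and so divisible by \<open>p\<close>. Since
  \<open>cyclotomic\<close> has value \<open>p\<close> at 1, subtracting a suitable multiple of it
  leaves a root at 1, and the factor \<open>X - 1\<close> can be split off.\<close>

lemma vanishing_poly_step:
  fixes f :: "int poly"
  assumes "poly (map_poly of_int f) (zeta p) = 0"
  obtains b g where "f = smult b cyclotomic + [:-1, 1:] * g" "poly (map_poly of_int g) (zeta p) = 0"
proof -
  have "poly (f - [:poly f 1:]) 1 = 0" by simp
  then obtain q where "f - [:poly f 1:] = [:-1, 1:] * q"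
    by (metis poly_eq_0_iff_dvd dvdE)
  hence "f = [:poly f 1:] + [:-1, 1:] * q" by (simp add: algebra_simps)
  hence "poly (map_poly of_int ([:poly f 1:] + [:-1, 1:] * q)) (zeta p) = 0" using assms by metis
  hence "of_int (poly f 1) = (zeta p - 1) * (- poly (map_poly of_int q) (zeta p))"
    by (simp add: hom_distribs algebra_simps eq_neg_iff_add_eq_0)
  moreover have "- poly (map_poly of_int q) (zeta p) \<in> almost_int p"
    by (intro cyc_int_ring_subset_almost_int cyc_int_ring_minus cyc_int_ringI)
  ultimately obtain b where "(of_int (poly f 1) :: complex) = of_int (int p * b)"
    by (metis rational_multiple_of_zeta_minus_1 Rats_of_int)
  hence "poly f 1 = int p * b" by (simp only: of_int_eq_iff)
  hence "poly (f - smult b cyclotomic) 1 = 0" by (simp add: poly_cyclotomic_1)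
  then obtain g where "f - smult b cyclotomic = [:-1, 1:] * g"
    by (metis poly_eq_0_iff_dvd dvdE)
  hence g: "f = smult b cyclotomic + [:-1, 1:] * g" by (simp add: algebra_simps)
  hence "poly (map_poly of_int (smult b cyclotomic + [:-1, 1:] * g)) (zeta p) = 0" using assms by metis
  hence "(zeta p - 1) * poly (map_poly of_int g) (zeta p) = 0"
    using poly_cyclotomic_zeta_power[of 1] p_gt_1 by (simp add: hom_distribs algebra_simps)
  hence "poly (map_poly of_int g) (zeta p) = 0" using zeta_neq_1 by simp
  with g show ?thesis by (rule that)
qed

text \<open>Iterates the previous step; with \<open>m = p\<close>, the power of \<open>X - 1\<close>
  can be traded for a factor \<open>p\<close>.\<close>

lemma vanishing_poly_power:
  fixes f :: "int poly"
  assumes "poly (map_poly of_int f) (zeta p) = 0"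
  shows "\<exists>s g. f = s * cyclotomic + [:-1, 1:] ^ m * g \<and> poly (map_poly of_int g) (zeta p) = 0"
proof (induction m)
  case 0
  show ?case using assms by (intro exI[of _ 0] exI[of _ f]) auto
next
  case (Suc m)
  then obtain s g where f: "f = s * cyclotomic + [:-1, 1:] ^ m * g"
    and g: "poly (map_poly of_int g) (zeta p) = 0" by auto
  obtain b g' where g': "g = smult b cyclotomic + [:-1, 1:] * g'"
    "poly (map_poly of_int g') (zeta p) = 0" using vanishing_poly_step[OF g] .
  have "f = (s + smult b ([:-1, 1:] ^ m)) * cyclotomic + [:-1, 1:] ^ Suc m * g'"
    unfolding f by (subst g'(1)) (simp only: algebra_simps power_Suc mult_smult_left mult_smult_right)
  with g'(2) show ?case by blast
qed

text \<open>Modulo the cyclotomic polynomial, \<open>(X - 1)\<^sup>p\<close> is divisible by \<open>p\<close>. Hence every integer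
  polynomial of low degree vanishing at \<open>\<zeta>\<close> is \<open>p\<close> times another one, and infinite descent
  applies.\<close>
lemma vanishing_poly_low_degree:
  fixes f :: "int poly"
  assumes "poly (map_poly of_int f) (zeta p) = 0" "degree f < p - 1"
  shows "f = 0"
  using assms
\<comment> \<open>The descent measure: writing a nonzero \<open>f\<close> as \<open>p\<close> times
  \<open>r\<close> shrinks the leading coefficient.\<close>
proof (induction "nat \<bar>lead_coeff f\<bar>" arbitrary: f rule: less_induct)
  case less
  obtain h where h: "[:-1, 1:] ^ p = [:-1, 1:] * cyclotomic + smult (int p) h"
    by (rule linear_power_mod_cyclotomic)
  obtain s g where f: "f = s * cyclotomic + [:-1, 1:] ^ p * g"
    and g: "poly (map_poly of_int g) (zeta p) = 0"
    using vanishing_poly_power[OF less.prems(1)] by blast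
  obtain q r where qr: "pseudo_divmod (h * g) cyclotomic = (q, r)" by force
  have div: "h * g = cyclotomic * q + r"
    using pseudo_divmod(1)[OF cyclotomic_neq_0 qr] by (simp add: lead_coeff_cyclotomic)
  have deg_r: "r = 0 \<or> degree r < p - 1"
    using pseudo_divmod(2)[OF cyclotomic_neq_0 qr] by (simp add: degree_cyclotomic)
  have eq: "f - smult (int p) r = cyclotomic * (s + [:-1, 1:] * g + smult (int p) q)"
  proof -
    have "f = s * cyclotomic + [:-1, 1:] * cyclotomic * g + smult (int p) (h * g)"
      unfolding f h by (simp add: algebra_simps)
    thus ?thesis unfolding div by (simp add: algebra_simps smult_add_right)
  qed
  have "degree (f - smult (int p) r) < p - 1"
    using deg_r less.prems(2) p_gt_2 by (intro degree_diff_less) auto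
  \<comment> \<open>A nonzero multiple of \<open>cyclotomic\<close> has degree at least
    \<open>p - 1\<close>.\<close>
  hence "f - smult (int p) r = 0"
    using degree_mult_eq[OF cyclotomic_neq_0] unfolding eq
    by (metis degree_cyclotomic mult_zero_right not_add_less1)
  hence fr: "f = smult (int p) r" by simp
  show ?case
  proof (rule ccontr)
    assume "f \<noteq> 0"
    hence "r \<noteq> 0" using fr by auto
    hence lr: "\<bar>lead_coeff r\<bar> > 0" by simp
    have "\<bar>lead_coeff f\<bar> = int p * \<bar>lead_coeff r\<bar>" by (simp add: fr abs_mult)
    also have "\<dots> > 1 * \<bar>lead_coeff r\<bar>" using lr p_gt_1 by (intro mult_strict_right_mono) auto
    finally have "nat \<bar>lead_coeff r\<bar> < nat \<bar>lead_coeff f\<bar>" using lr by linarith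
    moreover have "poly (map_poly of_int r) (zeta p) = 0"
      using less.prems(1) p_pos by (simp add: fr hom_distribs)
    ultimately have "r = 0" using less.hyps deg_r by blast
    with \<open>r \<noteq> 0\<close> show False by simp
  qed
qed

text \<open>The form in which irreducibility is used. After clearing denominators and dividing by
  \<open>cyclotomic\<close>, the remainder vanishes at \<open>zeta p\<close> in low degree, so it is
  zero; \<open>cyclotomic\<close> itself vanishes at every conjugate.\<close>

lemma vanishing_rat_poly:
  fixes f :: "rat poly"
  assumes "poly (map_poly of_rat f) (zeta p) = 0" and "\<not> p dvd j"
  shows "poly (map_poly of_rat f) (zeta p ^ j) = 0"
proof -
  obtain D :: int and F where D: "D > 0" "smult (of_int D) f = map_poly of_int F"
    by (rule rat_poly_clear_denominator)
  have ev: "of_int D * poly (map_poly of_rat f) w = poly (map_poly of_int F) w" for w :: complex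
  proof -
    have "poly (map_poly of_rat (smult (of_int D) f)) w = poly (map_poly of_rat (map_poly of_int F)) w"
      by (simp only: D(2))
    moreover have "map_poly of_rat (map_poly of_int F) = (map_poly of_int F :: complex poly)"
      by (simp add: map_poly_map_poly o_def)
    ultimately show ?thesis by (simp add: hom_distribs)
  qed
  obtain q r where qr: "pseudo_divmod F cyclotomic = (q, r)" by force
  have F: "F = cyclotomic * q + r"
    using pseudo_divmod(1)[OF cyclotomic_neq_0 qr] by (simp add: lead_coeff_cyclotomic)
  have "poly (map_poly of_int F) (zeta p) = 0" using ev[of "zeta p"] assms(1) by simp
  hence "poly (map_poly of_int r) (zeta p) = 0"
    using poly_cyclotomic_zeta_power[of 1] p_gt_1 by (simp add: F hom_distribs)
  moreover have "r = 0 \<or> degree r < p - 1"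
    using pseudo_divmod(2)[OF cyclotomic_neq_0 qr] by (simp add: degree_cyclotomic)
  ultimately have "r = 0" using vanishing_poly_low_degree by blast
  hence "poly (map_poly of_int F) (zeta p ^ j) = 0"
    using poly_cyclotomic_zeta_power[OF assms(2)] by (simp add: F hom_distribs)
  thus ?thesis using ev[of "zeta p ^ j"] D(1) by simp
qed

end

section \<open>Integral elements of the cyclotomic field\<close>

interpretation of_rat_poly_hom: map_poly_comm_ring_hom "of_rat :: rat \<Rightarrow> complex" ..

lemma cyc_fieldI: "poly (map_poly of_rat f) (zeta p) \<in> cyc_field p"
  by (auto simp: cyc_field_def)

lemma cyc_field_add [intro]:
  "\<lbrakk>u \<in> cyc_field p; v \<in> cyc_field p\<rbrakk> \<Longrightarrow> u + v \<in> cyc_field p"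
  by (auto simp: cyc_field_def) (metis of_rat_hom.map_poly_hom_add poly_add)

lemma cyc_field_mult [intro]:
  "\<lbrakk>u \<in> cyc_field p; v \<in> cyc_field p\<rbrakk> \<Longrightarrow> u * v \<in> cyc_field p"
  by (auto simp: cyc_field_def) (metis of_rat_poly_hom.hom_mult poly_mult)

lemma cyc_int_ring_subset_cyc_field: "u \<in> cyc_int_ring p \<Longrightarrow> u \<in> cyc_field p"
proof -
  assume "u \<in> cyc_int_ring p"
  then obtain f :: "int poly" where "u = poly (map_poly of_int f) (zeta p)"
    by (auto simp: cyc_int_ring_def)
  also have "map_poly of_int f = (map_poly of_rat (map_poly of_int f) :: complex poly)"
    by (simp add: map_poly_map_poly o_def)
  finally show ?thesis by (auto simp: cyc_field_def)
qed

lemma cyc_field_power [intro]: "u \<in> cyc_field p \<Longrightarrow> u ^ k \<in> cyc_field p"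
  by (induction k) (auto intro: cyc_int_ring_subset_cyc_field)

lemma cyc_field_sum [intro]:
  "(\<And>i. i \<in> S \<Longrightarrow> g i \<in> cyc_field p) \<Longrightarrow> (\<Sum>i\<in>S. g i) \<in> cyc_field p"
  by (induction S rule: infinite_finite_induct) (auto intro: cyc_int_ring_subset_cyc_field)

lemma cyc_fieldE:
  assumes "u \<in> cyc_field p" "p > 0"
  obtains q :: "nat \<Rightarrow> rat" and f where "u = poly (map_poly of_rat f) (zeta p)"
    "\<And>w. w ^ p = 1 \<Longrightarrow> poly (map_poly of_rat f) w = (\<Sum>k<p. of_rat (q k) * (w::complex) ^ k)"
proof -
  obtain f where f: "u = poly (map_poly of_rat f) (zeta p)"
    using assms(1) by (auto simp: cyc_field_def)
  obtain q :: "nat \<Rightarrow> rat" where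
    "\<And>w :: complex. w ^ p = 1 \<Longrightarrow> poly (map_poly of_rat f) w = (\<Sum>k<p. of_rat (q k) * w ^ k)"
    using poly_eq_sum_lessThan_root_of_unity[OF of_rat_hom.comm_ring_hom_axioms assms(2)] by metis
  thus ?thesis using that f by blast
qed

lemma cyc_field_denominator:
  assumes "u \<in> cyc_field p"
  obtains D :: int where "D > 0" "of_int D * u \<in> cyc_int_ring p"
proof -
  obtain f where f: "u = poly (map_poly of_rat f) (zeta p)"
    using assms by (auto simp: cyc_field_def)
  obtain D :: int and F where D: "D > 0" "smult (of_int D) f = map_poly of_int F"
    by (rule rat_poly_clear_denominator)
  have "map_poly of_rat (map_poly of_int F) = (map_poly of_int F :: complex poly)"
    by (simp add: map_poly_map_poly o_def)
  hence "of_int D * u = poly (map_poly of_int F) (zeta p)"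
    unfolding f by (metis D(2) of_rat_hom.map_poly_hom_smult of_rat_of_int_eq poly_smult)
  thus ?thesis using that[OF D(1)] cyc_int_ringI by simp
qed

text \<open>A monic equation of degree \<open>d\<close> reduces all powers of \<open>w\<close> to \<open>1, w, \<dots>, w\<^sup>d\<^sup>-\<^sup>1\<close>, whose
  denominators are bounded.\<close>
lemma almost_int_if_algebraic_int:
  assumes "algebraic_int w" "w \<in> cyc_field p"
  shows "w \<in> almost_int p"
proof -
  obtain F :: "int poly" where F: "lead_coeff F = 1" "poly (map_poly of_int F) w = 0"
    using assms(1) by (auto simp: algebraic_int_def)
  define d where "d = degree F"
  have "\<exists>D::int. D > 0 \<and> of_int D * w ^ i \<in> cyc_int_ring p" for i
    using cyc_field_denominator[OF cyc_field_power[OF assms(2)]] by metis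
  then obtain E :: "nat \<Rightarrow> int" where E: "\<And>i. E i > 0" "\<And>i. of_int (E i) * w ^ i \<in> cyc_int_ring p"
    by metis
  define D where "D = (\<Prod>i<d. E i)"
  have "D > 0" using E(1) by (auto simp: D_def intro: prod_pos)
  have w_d: "w ^ d = - (\<Sum>i<d. of_int (coeff F i) * w ^ i)"
  proof -
    have "0 = (\<Sum>i\<le>d. of_int (coeff F i) * w ^ i)"
      using F(2) by (simp add: poly_altdef d_def coeff_map_poly)
    also have "{..d} = insert d {..<d}" by auto
    also have "(\<Sum>i\<in>\<dots>. of_int (coeff F i) * w ^ i) = w ^ d + (\<Sum>i<d. of_int (coeff F i) * w ^ i)"
      using F(1) by (simp add: d_def)
    finally show ?thesis by (simp add: eq_neg_iff_add_eq_0)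
  qed
  have "of_int D * w ^ m \<in> cyc_int_ring p" for m
  proof (induction m rule: less_induct)
    case (less m)
    show ?case
    proof (cases "m < d")
      case True
      hence "D = (\<Prod>i\<in>{..<d}-{m}. E i) * E m"
        unfolding D_def by (subst prod.remove[of _ m]) auto
      hence "of_int D * w ^ m = of_int (\<Prod>i\<in>{..<d}-{m}. E i) * (of_int (E m) * w ^ m)"
        by simp
      also have "\<dots> \<in> cyc_int_ring p" by (intro cyc_int_ring_mult E of_int_in_cyc_int_ring)
      finally show ?thesis .
    next
      case False
      hence "w ^ m = w ^ (m - d) * w ^ d" by (simp flip: power_add)
      hence "of_int D * w ^ m = - (\<Sum>i<d. of_int (coeff F i) * (of_int D * w ^ (m - d + i)))"
        by (simp add: w_d sum_distrib_left power_add mult_ac)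
      also have "\<dots> \<in> cyc_int_ring p"
        using False
        by (intro cyc_int_ring_minus cyc_int_ring_sum cyc_int_ring_mult less of_int_in_cyc_int_ring) auto
      finally show ?thesis .
    qed
  qed
  thus ?thesis using \<open>D > 0\<close> by (auto simp: almost_int_def)
qed

context odd_prime_cyclotomic
begin

text \<open>Shows that the choice made in \<open>cyc_sigma\<close> does not depend on the
  representing polynomial.\<close>

lemma conjugate_well_defined:
  assumes "poly (map_poly of_rat f) (zeta p) = poly (map_poly of_rat g) (zeta p)" "\<not> p dvd j"
  shows "poly (map_poly of_rat f) (zeta p ^ j) = poly (map_poly of_rat g) (zeta p ^ j)"
  using vanishing_rat_poly[of "f - g" j] assms by (simp add: of_rat_poly_hom.hom_minus)

lemma poly_zeta_power_in_cyc_field: "poly (map_poly of_rat f) (zeta p ^ j) \<in> cyc_field p"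
  using cyc_fieldI[of "pcompose f (monom 1 j)" p]
  by (simp add: of_rat_hom.map_poly_pcompose poly_pcompose poly_monom)

text \<open>The monic equation of an element is itself a rational polynomial relation satisfied by
  \<open>zeta p\<close>, so it transfers to \<open>zeta p ^ j\<close>.\<close>

lemma algebraic_int_conjugate:
  assumes "algebraic_int (poly (map_poly of_rat f) (zeta p))" "\<not> p dvd j"
  shows "algebraic_int (poly (map_poly of_rat f) (zeta p ^ j))"
proof -
  obtain F :: "int poly" where F: "lead_coeff F = 1"
    "poly (map_poly of_int F) (poly (map_poly of_rat f) (zeta p)) = 0"
    using assms(1) by (auto simp: algebraic_int_def)
  define G where "G = pcompose (map_poly of_int F) f"
  have G: "poly (map_poly of_rat G) w = poly (map_poly of_int F) (poly (map_poly of_rat f) w)"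
    for w :: complex
    by (simp add: G_def of_rat_hom.map_poly_pcompose poly_pcompose map_poly_map_poly o_def)
  show ?thesis
    using vanishing_rat_poly[OF _ assms(2), of G] F unfolding algebraic_int_def G by auto
qed

text \<open>The powers of zeta sum to zero, so the \<open>q k\<close> are determined only up to a
  common shift; integrality is therefore proved for the differences
  \<open>q t - q 0\<close>.\<close>

lemma algebraic_int_in_cyc_int_ring:
  assumes "algebraic_int y" "y \<in> cyc_field p"
  shows "y \<in> cyc_int_ring p"
proof -
  obtain q :: "nat \<Rightarrow> rat" and f where f: "y = poly (map_poly of_rat f) (zeta p)"
    and q: "\<And>w. w ^ p = 1 \<Longrightarrow> poly (map_poly of_rat f) w = (\<Sum>k<p. of_rat (q k) * (w::complex) ^ k)"
    using cyc_fieldE[OF assms(2) p_pos] by metis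
  define Y where "Y j = poly (map_poly of_rat f) (zeta p ^ j)" for j
  have Y_q: "Y j = (\<Sum>k<p. of_rat (q k) * zeta p ^ (j * k))" for j
    unfolding Y_def by (subst q) (simp_all add: p_pos power_mult)
  have Y_int: "Y j \<in> almost_int p" if "\<not> p dvd j" for j
    unfolding Y_def using assms that f
    by (intro almost_int_if_algebraic_int algebraic_int_conjugate poly_zeta_power_in_cyc_field) auto
  have "\<exists>c::int. q t - q 0 = of_int c" if t: "t < p" for t
  proof -
    \<comment> \<open>The trace of \<open>y\<close> times \<open>zeta^(-t) - 1\<close>, with
      \<open>p - t\<close> standing for \<open>-t\<close>. The index \<open>j = 0\<close>, for which
      \<open>Y 0\<close> is no conjugate of \<open>y\<close>, contributes zero because of the second
      factor.\<close>
    define T where "T = (\<Sum>j<p. Y j * (zeta p ^ (j * (p - t)) - 1))"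
    have "T = (\<Sum>j<p. \<Sum>k<p. of_rat (q k) * (zeta p ^ (j * (k + (p - t))) - zeta p ^ (j * k)))"
      unfolding T_def Y_q sum_distrib_right
      by (intro sum.cong refl) (simp add: algebra_simps power_add)
    also have "\<dots> = (\<Sum>k<p. of_rat (q k) *
        ((\<Sum>j<p. zeta p ^ (j * (k + (p - t)))) - (\<Sum>j<p. zeta p ^ (j * k))))"
      by (subst sum.swap) (simp only: sum_distrib_left sum_subtractf[symmetric])
    also have "\<dots> = (\<Sum>k<p. of_rat (q k) * ((if k = t then of_nat p else 0) - (if k = 0 then of_nat p else 0)))"
    proof (intro sum.cong refl)
      fix k assume k: "k \<in> {..<p}"
      have "p dvd k \<longleftrightarrow> k = 0" using k by (auto dest: dvd_imp_le)
      moreover have "p dvd k + (p - t) \<longleftrightarrow> k = t"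
      proof
        assume "p dvd k + (p - t)"
        then obtain c where c: "k + (p - t) = p * c" by (elim dvdE)
        have "0 < p * c" "p * c < p * 2" unfolding c[symmetric] using k t by auto
        hence "c = 1" by (simp add: p_pos)
        thus "k = t" using c k t by simp
      qed (use t in auto)
      ultimately show "of_rat (q k) * ((\<Sum>j<p. zeta p ^ (j * (k + (p - t)))) - (\<Sum>j<p. zeta p ^ (j * k)))
          = of_rat (q k) * ((if k = t then of_nat p else 0) - (if k = 0 then of_nat p else 0))"
        by (simp add: sum_zeta_powers[OF p_pos])
    qed
    also have "\<dots> = of_rat (of_nat p * (q t - q 0))"
      using t p_pos by (simp add: right_diff_distrib sum_subtractf of_rat_mult of_rat_diff
        if_distrib[of "\<lambda>x. _ * x"] sum.delta cong: if_cong)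
    finally have T: "T = of_rat (of_nat p * (q t - q 0))" .
    \<comment> \<open>Each \<open>zeta p ^ (j * (p - t)) - 1\<close> is \<open>zeta p - 1\<close>
      times a geometric sum. The index 0 is dropped because \<open>Y_int\<close> covers only
      \<open>j\<close> prime to \<open>p\<close>.\<close>
    define \<gamma> where "\<gamma> = (\<Sum>j\<in>{0<..<p}. Y j * (\<Sum>i<j * (p - t). zeta p ^ i))"
    have "T = (\<Sum>j\<in>{0<..<p}. Y j * (zeta p ^ (j * (p - t)) - 1))"
      unfolding T_def by (rule sum.mono_neutral_right) auto
    also have "\<dots> = (zeta p - 1) * \<gamma>"
      unfolding \<gamma>_def sum_distrib_left
      by (intro sum.cong refl) (simp add: power_diff_1_eq mult_ac sum_distrib_left)
    finally have T': "T = (zeta p - 1) * \<gamma>" .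
    have "\<gamma> \<in> almost_int p"
      unfolding \<gamma>_def
      by (intro almost_int_sum almost_int_mult Y_int cyc_int_ring_subset_almost_int
            cyc_int_ring_sum cyc_int_ring_power zeta_in_cyc_int_ring)
         (auto dest: dvd_imp_le)
    then obtain c where "T = of_int (int p * c)"
      using rational_multiple_of_zeta_minus_1[OF _ T'] T by (metis Rats_of_rat)
    hence "(of_rat (of_nat p * (q t - q 0)) :: complex) = of_rat (of_nat p * of_int c)"
      unfolding T by (simp add: of_rat_mult)
    hence "of_nat p * (q t - q 0) = of_nat p * of_int c" by (simp only: of_rat_eq_iff)
    thus ?thesis using p_pos by auto
  qed
  then obtain c :: "nat \<Rightarrow> int" where c: "\<And>t. t < p \<Longrightarrow> q t - q 0 = of_int (c t)" by metis
  \<comment> \<open>The subtracted sum is zero; it shifts all coefficients by \<open>q 0\<close> and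
    so makes them integers.\<close>
  have "y = (\<Sum>k<p. of_rat (q k) * zeta p ^ k) - of_rat (q 0) * (\<Sum>k<p. zeta p ^ k)"
    using sum_zeta_powers[OF p_pos, of 1] q[of "zeta p"] p_gt_1 by (simp add: f p_pos)
  also have "\<dots> = (\<Sum>k<p. of_rat (q k - q 0) * zeta p ^ k)"
    by (simp add: sum_distrib_left sum_subtractf of_rat_diff left_diff_distrib)
  also have "\<dots> = (\<Sum>k<p. of_int (c k) * zeta p ^ k)"
    by (intro sum.cong refl) (simp add: c)
  also have "\<dots> \<in> cyc_int_ring p"
    by (intro cyc_int_ring_sum cyc_int_ring_mult cyc_int_ring_power of_int_in_cyc_int_ring
        zeta_in_cyc_int_ring)
  finally show ?thesis .
qed

end

section \<open>The Galois action\<close>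

locale cyclotomic_galois = odd_prime_cyclotomic +
  fixes r :: nat
  assumes primroot: "residue_primroot p r"
begin

abbreviation \<sigma> :: "complex \<Rightarrow> complex" where
  "\<sigma> \<equiv> cyc_sigma p r"

lemma ord_r: "ord p r = p - 1"
  using primroot prime_p by (simp add: residue_primroot_def totient_prime)

lemma not_p_dvd_r_power: "\<not> p dvd r ^ i"
proof -
  have "coprime p (r ^ i)" using primroot by (simp add: residue_primroot_def)
  thus ?thesis using prime_p by (metis coprime_absorb_left not_prime_unit)
qed

lemma sigma_poly: "\<sigma> (poly (map_poly of_rat f) (zeta p)) = poly (map_poly of_rat f) (zeta p ^ r)"
  unfolding cyc_sigma_def
proof (rule some_equality)
  fix w assume "\<exists>g. poly (map_poly of_rat g) (zeta p) = poly (map_poly of_rat f) (zeta p) \<and>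
    w = poly (map_poly of_rat g) (zeta p ^ r)"
  then obtain g where g: "poly (map_poly of_rat g) (zeta p) = poly (map_poly of_rat f) (zeta p)"
    and w: "w = poly (map_poly of_rat g) (zeta p ^ r)" by blast
  show "w = poly (map_poly of_rat f) (zeta p ^ r)"
    unfolding w using g not_p_dvd_r_power[of 1] by (intro conjugate_well_defined) auto
qed blast

lemma sigma_funpow_poly:
  "(\<sigma> ^^ i) (poly (map_poly of_rat f) (zeta p)) = poly (map_poly of_rat f) (zeta p ^ (r ^ i))"
proof (induction i)
  case (Suc i)
  \<comment> \<open>Composing with \<open>X ^ k\<close> turns evaluation at a power of zeta into
    evaluation at zeta, the form required by \<open>sigma_poly\<close>.\<close>
  have subst: "poly (map_poly of_rat (pcompose f (monom 1 k))) w = poly (map_poly of_rat f) (w ^ k)"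
    for k and w :: complex
    by (simp add: of_rat_hom.map_poly_pcompose poly_pcompose poly_monom)
  have "(\<sigma> ^^ Suc i) (poly (map_poly of_rat f) (zeta p)) = \<sigma> (poly (map_poly of_rat f) (zeta p ^ (r ^ i)))"
    by (simp add: Suc)
  also have "\<dots> = poly (map_poly of_rat f) ((zeta p ^ r) ^ (r ^ i))"
    using sigma_poly[of "pcompose f (monom 1 (r ^ i))"] unfolding subst .
  finally show ?case by (simp add: power_mult[symmetric])
qed simp

lemma sigma_funpow_add:
  assumes "u \<in> cyc_field p" "v \<in> cyc_field p"
  shows "(\<sigma> ^^ i) (u + v) = (\<sigma> ^^ i) u + (\<sigma> ^^ i) v"
proof -
  obtain f g where "u = poly (map_poly of_rat f) (zeta p)" "v = poly (map_poly of_rat g) (zeta p)"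
    using assms by (auto simp: cyc_field_def)
  thus ?thesis using sigma_funpow_poly[of i "f + g"]
    by (simp add: sigma_funpow_poly of_rat_poly_hom.hom_add)
qed

lemma sigma_funpow_mult:
  assumes "u \<in> cyc_field p" "v \<in> cyc_field p"
  shows "(\<sigma> ^^ i) (u * v) = (\<sigma> ^^ i) u * (\<sigma> ^^ i) v"
proof -
  obtain f g where "u = poly (map_poly of_rat f) (zeta p)" "v = poly (map_poly of_rat g) (zeta p)"
    using assms by (auto simp: cyc_field_def)
  thus ?thesis using sigma_funpow_poly[of i "f * g"]
    by (simp add: sigma_funpow_poly of_rat_poly_hom.hom_mult)
qed

lemma sigma_funpow_of_int [simp]: "(\<sigma> ^^ i) (of_int a) = of_int a"
  using sigma_funpow_poly[of i "[:of_int a:]"] by (simp add: of_rat_hom.map_poly_pCons_hom)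

lemma sigma_funpow_0 [simp]: "(\<sigma> ^^ i) 0 = 0"
  using sigma_funpow_of_int[of i 0] by simp

lemma sigma_funpow_1 [simp]: "(\<sigma> ^^ i) 1 = 1"
  using sigma_funpow_of_int[of i 1] by simp

lemma sigma_funpow_zeta_power: "(\<sigma> ^^ i) (zeta p ^ k) = zeta p ^ (r ^ i * k)"
  using sigma_funpow_poly[of i "monom 1 k"] by (simp add: poly_monom power_mult)

lemma sigma_funpow_in_cyc_field: "u \<in> cyc_field p \<Longrightarrow> (\<sigma> ^^ i) u \<in> cyc_field p"
proof -
  assume "u \<in> cyc_field p"
  then obtain f where "u = poly (map_poly of_rat f) (zeta p)" by (auto simp: cyc_field_def)
  thus ?thesis by (simp add: sigma_funpow_poly poly_zeta_power_in_cyc_field)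
qed

lemma sigma_funpow_in_cyc_int_ring:
  assumes "u \<in> cyc_int_ring p"
  shows "(\<sigma> ^^ i) u \<in> cyc_int_ring p"
proof -
  obtain f :: "int poly" where f: "u = poly (map_poly of_int f) (zeta p)"
    using assms by (auto simp: cyc_int_ring_def)
  have "map_poly of_int f = (map_poly of_rat (map_poly of_int f) :: complex poly)"
    by (simp add: map_poly_map_poly o_def)
  hence "(\<sigma> ^^ i) u = poly (map_poly of_int f) (zeta p ^ (r ^ i))"
    using sigma_funpow_poly[of i "map_poly of_int f"] f by simp
  thus ?thesis by (simp add: poly_of_int_in_cyc_int_ring cyc_int_ring_power)
qed

lemma sigma_funpow_minus: "u \<in> cyc_field p \<Longrightarrow> (\<sigma> ^^ i) (- u) = - (\<sigma> ^^ i) u"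
  using sigma_funpow_mult[of "-1" u i] sigma_funpow_of_int[of i "-1"]
    cyc_int_ring_subset_cyc_field[OF of_int_in_cyc_int_ring[of "-1"]] by simp

lemma sigma_funpow_sum:
  "(\<And>j. j \<in> S \<Longrightarrow> g j \<in> cyc_field p) \<Longrightarrow> (\<sigma> ^^ i) (\<Sum>j\<in>S. g j) = (\<Sum>j\<in>S. (\<sigma> ^^ i) (g j))"
  by (induction S rule: infinite_finite_induct) (auto simp: sigma_funpow_add cyc_field_sum)

lemma sigma_funpow_prod:
  "(\<And>j. j \<in> S \<Longrightarrow> g j \<in> cyc_int_ring p) \<Longrightarrow> (\<sigma> ^^ i) (\<Prod>j\<in>S. g j) = (\<Prod>j\<in>S. (\<sigma> ^^ i) (g j))"
  by (induction S rule: infinite_finite_induct)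
     (auto simp: sigma_funpow_mult cyc_int_ring_prod cyc_int_ring_subset_cyc_field)

lemma sigma_funpow_order:
  assumes "u \<in> cyc_field p"
  shows "(\<sigma> ^^ (p - 1)) u = u"
proof -
  obtain f where "u = poly (map_poly of_rat f) (zeta p)" using assms by (auto simp: cyc_field_def)
  moreover have "zeta p ^ (r ^ (p - 1)) = zeta p ^ 1"
    using ord[of r p] by (intro zeta_power_cong p_pos) (simp add: ord_r)
  ultimately show ?thesis by (simp add: sigma_funpow_poly)
qed

text \<open>The half power of a primitive root squares to 1 modulo \<open>p\<close> but is not 1,
  because the order is \<open>p - 1\<close>; hence it is -1.\<close>

lemma r_power_half: "p dvd r ^ ((p - 1) div 2) + 1"
proof -
  define R where "R = int r ^ ((p - 1) div 2)"
  have even: "even (p - 1)" using odd_p by simp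
  have "[r ^ ((p - 1) div 2) \<noteq> 1] (mod p)"
    using p_gt_2 by (intro ord_minimal[rule_format]) (simp_all add: ord_r)
  hence not1: "\<not> int p dvd R - 1"
    by (simp add: R_def cong_iff_dvd_diff flip: cong_int_iff)
  have "[r ^ (p - 1) = 1] (mod p)" using ord[of r p] by (simp add: ord_r)
  hence "int p dvd int r ^ (p - 1) - 1"
    by (simp add: cong_iff_dvd_diff flip: cong_int_iff)
  also have "int r ^ (p - 1) = R * R"
    unfolding R_def using even by (metis dvd_mult_div_cancel mult_2 power_add)
  also have "R * R - 1 = (R - 1) * (R + 1)" by (simp add: algebra_simps)
  finally have "int p dvd R + 1"
    using not1 prime_p by (metis prime_dvd_mult_iff prime_nat_int_transfer)
  hence "int p dvd int (r ^ ((p - 1) div 2) + 1)" by (simp add: R_def add.commute)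
  thus ?thesis by (simp only: of_nat_dvd_iff)
qed

text \<open>The integer \<open>lam\<close> may be negative; reduction to a natural exponent makes
  the lemmas on \<open>\<sigma>\<close> applicable.\<close>

lemma zeta_powi_mod: "zeta p powi a = zeta p ^ nat (a mod int p)"
proof -
  have "zeta p powi a = zeta p powi (int p * (a div int p) + a mod int p)" by simp
  also have "\<dots> = (zeta p powi int p) powi (a div int p) * zeta p powi (a mod int p)"
    by (simp only: power_int_add power_int_mult zeta_neq_0 simp_thms)
  also have "\<dots> = zeta p ^ nat (a mod int p)"
    using p_pos by (simp add: power_int_def)
  finally show ?thesis .
qed

section \<open>The element beta as an eigenvector of sigma\<close>

context
  fixes lam :: int and \<beta> :: complex
  assumes lam: "[lam * (int r - 1) = 1] (mod int p)"
    and beta: "\<beta> = zeta p powi lam * (\<Prod>j\<in>{0..(p - 3) div 2}. (1 - zeta p ^ (r ^ j)))"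
begin

lemma beta_in_cyc_int_ring: "\<beta> \<in> cyc_int_ring p"
  unfolding beta zeta_powi_mod
  by (intro cyc_int_ring_mult cyc_int_ring_power cyc_int_ring_prod cyc_int_ring_diff
      zeta_in_cyc_int_ring one_in_cyc_int_ring)

text \<open>Applying \<open>\<sigma>\<close> to the product replaces its first factor by
  \<open>1 - zeta^(-1)\<close>, which equals \<open>-zeta^(-1) (1 - zeta)\<close>. The choice of
  \<open>lam\<close> gives the compensating factor zeta.\<close>

lemma sigma_beta: "\<sigma> \<beta> = - \<beta>"
proof -
  define m where "m = (p - 1) div 2"
  define \<alpha> where "\<alpha> = (\<Prod>j<m. 1 - zeta p ^ (r ^ j))"
  define L where "L = nat (lam mod int p)"
  have "{0..(p - 3) div 2} = {..<m}" using odd_p p_gt_2 by (auto simp: m_def elim!: oddE)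
  hence \<beta>: "\<beta> = zeta p ^ L * \<alpha>" by (simp add: beta zeta_powi_mod L_def \<alpha>_def)
  have in_ring: "1 - zeta p ^ k \<in> cyc_int_ring p" for k
    by (intro cyc_int_ring_diff cyc_int_ring_power) auto
  have in_field: "zeta p ^ L \<in> cyc_field p" "\<alpha> \<in> cyc_field p"
    unfolding \<alpha>_def
    by (intro cyc_int_ring_subset_cyc_field cyc_int_ring_power cyc_int_ring_prod in_ring
        zeta_in_cyc_int_ring)+
  have sigma_factor: "\<sigma> (1 - zeta p ^ k) = 1 - zeta p ^ (r * k)" for k
    using sigma_funpow_add[of 1 "- (zeta p ^ k)" 1] sigma_funpow_minus[of "zeta p ^ k" 1]
      sigma_funpow_zeta_power[of 1 k] sigma_funpow_1[of 1]
    by (auto simp: cyc_int_ring_subset_cyc_field cyc_int_ring_power cyc_int_ring_minus)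
  have "\<sigma> \<alpha> = (\<Prod>j<m. 1 - zeta p ^ (r ^ Suc j))"
    using sigma_funpow_prod[of "{..<m}" "\<lambda>j. 1 - zeta p ^ (r ^ j)" 1] in_ring
    by (simp add: \<alpha>_def sigma_factor)
  \<comment> \<open>The product over \<open>j \<le> m\<close> is split once at its first factor and
    once at its last.\<close>
  hence "(1 - zeta p) * \<sigma> \<alpha> = (\<Prod>j<Suc m. 1 - zeta p ^ (r ^ j))"
    by (subst prod.lessThan_Suc_shift) simp
  also have "\<dots> = \<alpha> * (1 - zeta p ^ (r ^ m))" by (simp add: \<alpha>_def)
  finally have eq: "(1 - zeta p) * \<sigma> \<alpha> = \<alpha> * (1 - zeta p ^ (r ^ m))" .
  have "zeta p ^ (r ^ m) * zeta p = 1"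
    using r_power_half zeta_power_eq_1_iff[OF p_pos, of "r ^ m + 1"]
    by (simp add: m_def mult.commute)
  hence "(1 - zeta p) * (zeta p * \<sigma> \<alpha>) = (1 - zeta p) * (- \<alpha>)"
    using arg_cong[OF eq, of "\<lambda>x. zeta p * x"] by (simp add: algebra_simps)
  moreover have "1 - zeta p \<noteq> 0" using zeta_neq_1 by simp
  ultimately have sigma_alpha: "zeta p * \<sigma> \<alpha> = - \<alpha>" by (metis mult_left_cancel)
  \<comment> \<open>This is the congruence for \<open>lam\<close> in the form
    \<open>r * lam = lam + 1\<close>.\<close>
  have "[int (r * L) = int (L + 1)] (mod int p)"
  proof -
    have "[int L = lam] (mod int p)" using p_pos by (simp add: L_def)
    hence "[int L * (int r - 1) = 1] (mod int p)"
      using lam cong_trans cong_scalar_right by blast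
    from cong_add[OF this cong_refl[of "int L"]] show ?thesis by (simp add: algebra_simps)
  qed
  hence "[r * L = L + 1] (mod p)" by (simp only: cong_int_iff)
  hence "\<sigma> (zeta p ^ L) = zeta p ^ L * zeta p"
    using sigma_funpow_zeta_power[of 1 L] zeta_power_cong[OF p_pos] by fastforce
  hence "\<sigma> \<beta> = zeta p ^ L * (zeta p * \<sigma> \<alpha>)"
    using sigma_funpow_mult[OF in_field, of 1] by (simp add: \<beta>)
  thus ?thesis by (simp add: sigma_alpha \<beta>)
qed

lemma sigma_funpow_beta: "(\<sigma> ^^ i) \<beta> = (-1) ^ i * \<beta>"
proof (induction i)
  case (Suc i)
  have "(-1) ^ i \<in> cyc_int_ring p" using of_int_in_cyc_int_ring[of "(-1) ^ i" p] by simp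
  hence "\<sigma> ((-1) ^ i * \<beta>) = (-1) ^ i * \<sigma> \<beta>"
    using sigma_funpow_mult[of "(-1) ^ i" \<beta> 1] sigma_funpow_of_int[of 1 "(-1) ^ i"]
    by (simp add: cyc_int_ring_subset_cyc_field beta_in_cyc_int_ring)
  thus ?case by (simp add: Suc sigma_beta)
qed simp

end

end

section \<open>The trace to K and the two inclusions\<close>

theorem theorem4:
  fixes n p r :: nat and lam :: int
    and \<alpha> z x :: complex and I :: "complex set"
  assumes n_odd: "odd n" and n_gt: "n > 1"
    and p_prime: "prime p" and p_cong: "[p = 1] (mod n)"
    and r_prim: "residue_primroot p r"
    and lam_def: "[lam * (int r - 1) = 1] (mod int p)"
    and alpha_def: "\<alpha> = (\<Prod>j\<in>{0..(p - 3) div 2}. (1 - zeta p ^ (r ^ j)))"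
    and z_def: "z = zeta p powi lam * \<alpha> * (1 - zeta p)"
    and x_def: "x = (\<Sum>j\<in>{1..(p - 1) div n}. (cyc_sigma p r ^^ (j * n)) z)"
    and I_def: "I = {\<Sum>i<n. of_int (c i) * (cyc_sigma p r ^^ i) x | c :: nat \<Rightarrow> int. True}"
    and hyp: "cyc_sigma p r x / x \<in> cyc_int_ring p"
  shows "I = {x * a | a. a \<in> ring_of_integers_K n p r}"
proof -
  have n_dvd: "n dvd p - 1"
    using p_cong prime_gt_1_nat[OF p_prime] by (metis cong_altdef_nat cong_sym less_imp_le_nat)
  have "p > 2"
    using dvd_imp_le[OF n_dvd] n_gt n_odd prime_gt_1_nat[OF p_prime] by (cases "n = 2") auto
  then interpret cyclotomic_galois p r
    by unfold_locales (use p_prime r_prim in auto)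
  define \<beta> where "\<beta> = zeta p powi lam * (\<Prod>j\<in>{0..(p - 3) div 2}. (1 - zeta p ^ (r ^ j)))"
  note beta_ring = beta_in_cyc_int_ring[OF lam_def \<beta>_def]
  note sigma_beta = sigma_funpow_beta[OF lam_def \<beta>_def]
  note field = cyc_int_ring_subset_cyc_field
  define M where "M = (p - 1) div n"
  have Mn: "M * n = p - 1" using n_dvd by (simp add: M_def)
  have "even (M * n)" using Mn odd_p by simp
  hence "even M" using n_odd by simp
  define Tr where "Tr u = (\<Sum>j\<in>{1..M}. (\<sigma> ^^ (j * n)) u)" for u
  have x_Tr: "x = Tr (\<beta> * (1 - zeta p))"
    by (simp add: x_def Tr_def M_def z_def alpha_def \<beta>_def)
  have Tr_add: "Tr (u + v) = Tr u + Tr v" if "u \<in> cyc_field p" "v \<in> cyc_field p" for u v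
    using that by (simp add: Tr_def sigma_funpow_add sum.distrib)
  have Tr_sum: "Tr (\<Sum>k\<in>S. g k) = (\<Sum>k\<in>S. Tr (g k))" if "\<And>k. k \<in> S \<Longrightarrow> g k \<in> cyc_field p"
    for S :: "nat set" and g
    unfolding Tr_def using that by (subst sum.swap) (simp add: sigma_funpow_sum)
  have Tr_of_int_mult: "Tr (of_int c * u) = of_int c * Tr u" if "u \<in> cyc_field p" for c u
    using that by (simp add: Tr_def sigma_funpow_mult field sum_distrib_left)
  have Tr_sigma: "Tr ((\<sigma> ^^ i) u) = (\<sigma> ^^ i) (Tr u)" if "u \<in> cyc_field p" for i u
    using that
    by (simp add: Tr_def sigma_funpow_sum sigma_funpow_in_cyc_field
        funpow_add[symmetric, THEN fun_cong, simplified] add.commute)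
  have Tr_fixed_mult: "Tr (u * a) = Tr u * a" if "u \<in> cyc_field p" "a \<in> fix_field n p r" for u a
  proof -
    have a: "a \<in> cyc_field p" "(\<sigma> ^^ n) a = a" using that(2) by (auto simp: fix_field_def)
    have "(\<sigma> ^^ (j * n)) a = a" for j
      using funpow_mod_eq[OF a(2), of "j * n"] by simp
    thus ?thesis using that(1) a(1) by (simp add: Tr_def sigma_funpow_mult sum_distrib_right)
  qed
  have sigma_Tr: "(\<sigma> ^^ n) (Tr u) = Tr u" if u: "u \<in> cyc_field p" for u
  proof -
    have "(\<sigma> ^^ n) (Tr u) = (\<Sum>j\<in>{1..M}. (\<sigma> ^^ (Suc j * n)) u)"
      using u unfolding Tr_def
      by (subst sigma_funpow_sum) (auto simp: sigma_funpow_in_cyc_field funpow_add)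
    also have "\<dots> = (\<Sum>j\<in>{2..Suc M}. (\<sigma> ^^ (j * n)) u)"
      by (rule sum.reindex_bij_witness[of _ "\<lambda>j. j - 1" Suc]) auto
    also have "\<dots> = Tr u"
    proof -
      \<comment> \<open>The shift trades the term \<open>j = 1\<close> for \<open>j = M + 1\<close>;
        these agree because \<open>\<sigma> ^^ (p - 1)\<close> is the identity on the field.\<close>
      have "(\<sigma> ^^ (Suc M * n)) u = (\<sigma> ^^ n) u"
        using sigma_funpow_order[OF u] by (simp add: funpow_add Mn)
      moreover have "M \<ge> 1" using Mn p_gt_1 by (cases M) auto
      hence "{1..M} = insert 1 {2..M}" "{2..Suc M} = insert (Suc M) {2..M}" by auto
      ultimately show ?thesis by (simp add: Tr_def)
    qed
    finally show ?thesis .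
  qed
  have beta_zeta: "\<beta> * zeta p ^ k \<in> cyc_int_ring p" for k
    by (intro cyc_int_ring_mult cyc_int_ring_power beta_ring zeta_in_cyc_int_ring)
  have Tr_beta: "Tr \<beta> = 0"
  proof -
    \<comment> \<open>For odd \<open>n\<close> the sign \<open>(-1) ^ (j * n)\<close> is
      \<open>(-1) ^ j\<close>, and an even number of alternating signs cancels.\<close>
    have "Tr \<beta> = (\<Sum>j\<in>{1..M}. (-1) ^ j * \<beta>)"
      unfolding Tr_def sigma_beta using n_odd
      by (intro sum.cong refl) (simp add: power_mult mult.commute[of _ n])
    also have "\<dots> = (\<Sum>j\<in>{1..M}. (-1) ^ j) * \<beta>" by (simp add: sum_distrib_right)
    also have "(\<Sum>j\<in>{1..M}. (-1) ^ j) = (0::complex)"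
      using \<open>even M\<close>
    proof (elim evenE)
      fix k assume "M = 2 * k"
      moreover have "(\<Sum>j\<in>{1..2 * k}. (-1) ^ j) = (0::complex)" by (induction k) auto
      ultimately show ?thesis by simp
    qed
    finally show ?thesis by simp
  qed
  have x_eq: "x = - Tr (\<beta> * zeta p)"
    using Tr_add[of "\<beta> * (1 - zeta p)" "\<beta> * zeta p"] beta_zeta[of 1] beta_ring Tr_beta
      cyc_int_ring_diff[OF beta_ring beta_zeta[of 1]]
    by (simp add: x_Tr field algebra_simps eq_neg_iff_add_eq_0)
  have x_ring: "x \<in> cyc_int_ring p"
    unfolding x_eq Tr_def using beta_zeta[of 1]
    by (intro cyc_int_ring_minus cyc_int_ring_sum sigma_funpow_in_cyc_int_ring) auto
  have x_fixed: "(\<sigma> ^^ n) x = x"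
    using sigma_Tr beta_zeta[of 1] x_Tr cyc_int_ring_diff[OF beta_ring beta_zeta[of 1]]
    by (simp add: field algebra_simps)
  have I_I: "(\<Sum>i<n. of_int (c i) * (\<sigma> ^^ i) x) \<in> I" for c
    unfolding I_def by auto
  have I_0: "0 \<in> I" using I_I[of "\<lambda>_. 0"] by simp
  have I_add: "u + v \<in> I" if uv: "u \<in> I" "v \<in> I" for u v
  proof -
    obtain c d :: "nat \<Rightarrow> int" where "u = (\<Sum>i<n. of_int (c i) * (\<sigma> ^^ i) x)"
      "v = (\<Sum>i<n. of_int (d i) * (\<sigma> ^^ i) x)" using uv by (auto simp: I_def)
    thus ?thesis using I_I[of "\<lambda>i. c i + d i"] by (simp add: distrib_right sum.distrib)
  qed
  have I_mult: "of_int k * u \<in> I" if u: "u \<in> I" for u k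
  proof -
    obtain c :: "nat \<Rightarrow> int" where "u = (\<Sum>i<n. of_int (c i) * (\<sigma> ^^ i) x)"
      using u by (auto simp: I_def)
    thus ?thesis using I_I[of "\<lambda>i. k * c i"] by (simp add: sum_distrib_left mult.assoc)
  qed
  have I_sum: "(\<Sum>k\<in>S. g k) \<in> I" if "\<And>k. k \<in> S \<Longrightarrow> g k \<in> I" for S :: "nat set" and g
    using that by (induction S rule: infinite_finite_induct) (auto simp: I_0 I_add)
  have I_sigma: "(\<sigma> ^^ i) x \<in> I" for i
  proof -
    \<comment> \<open>As \<open>\<sigma> ^^ n\<close> fixes \<open>x\<close>, every conjugate of
      \<open>x\<close> is already one of the \<open>n\<close> generators.\<close>
    have "(\<sigma> ^^ i) x = (\<sigma> ^^ (i mod n)) x" using funpow_mod_eq[OF x_fixed] by simp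
    also have "\<dots> = (\<Sum>k<n. if k = i mod n then (\<sigma> ^^ k) x else 0)"
      using n_gt by (simp add: sum.delta)
    also have "\<dots> = (\<Sum>k<n. of_int (if k = i mod n then 1 else 0) * (\<sigma> ^^ k) x)"
      by (intro sum.cong) auto
    also have "\<dots> \<in> I" by (rule I_I)
    finally show ?thesis .
  qed
  have Tr_in_I: "Tr (\<beta> * zeta p ^ k) \<in> I" if "k < p" for k
  proof (cases "k = 0")
    case True
    thus ?thesis by (simp add: Tr_beta I_0)
  next
    case False
    hence "k \<in> totatives p" using that p_prime by (auto simp: totatives_prime)
    then obtain i where i: "k = r ^ i mod p"
      using residue_primroot_is_generator[OF p_gt_1 r_prim] by (auto simp: bij_betw_def)
    \<comment> \<open>The primitive root moves zeta to any nontrivial power; the sign undoes the one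
      picked up by \<open>\<beta>\<close>.\<close>
    have "\<beta> * zeta p ^ k = of_int ((-1) ^ i) * (\<sigma> ^^ i) (\<beta> * zeta p)"
    proof -
      have "zeta p ^ k = zeta p ^ (r ^ i)" unfolding i by (rule power_mod_eq_of_power_eq_1) (simp add: p_pos)
      moreover have "(\<sigma> ^^ i) (\<beta> * zeta p) = (-1) ^ i * \<beta> * zeta p ^ (r ^ i)"
        using sigma_funpow_zeta_power[of i 1] by (simp add: sigma_funpow_mult field beta_ring sigma_beta)
      ultimately show ?thesis by (simp flip: power_mult_distrib mult.assoc)
    qed
    hence "Tr (\<beta> * zeta p ^ k) = of_int ((-1) ^ i) * (\<sigma> ^^ i) (Tr (\<beta> * zeta p))"
      using field[OF beta_zeta[of 1]]
      by (simp only: Tr_of_int_mult Tr_sigma sigma_funpow_in_cyc_field power_one_right)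
    also have "Tr (\<beta> * zeta p) = - x" by (simp add: x_eq)
    also have "of_int ((-1) ^ i) * (\<sigma> ^^ i) (- x) = of_int (- ((-1) ^ i)) * (\<sigma> ^^ i) x"
      by (simp add: sigma_funpow_minus field x_ring)
    finally show ?thesis using I_mult[OF I_sigma] by metis
  qed
  show ?thesis
  proof (intro equalityI subsetI)
    fix y assume "y \<in> {x * a | a. a \<in> ring_of_integers_K n p r}"
    then obtain a where y: "y = x * a" and a: "a \<in> fix_field n p r" "algebraic_int a"
      by (auto simp: ring_of_integers_K_def)
    \<comment> \<open>Here the equality of the ring of integers with Z[zeta] enters: it provides an
      expansion with integer coefficients.\<close>
    have "a \<in> cyc_int_ring p"
      using a by (intro algebraic_int_in_cyc_int_ring) (auto simp: fix_field_def)
    hence "(1 - zeta p) * a \<in> cyc_int_ring p" by (intro cyc_int_ring_mult cyc_int_ring_diff) auto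
    then obtain c :: "nat \<Rightarrow> int" where c: "(1 - zeta p) * a = (\<Sum>k<p. of_int (c k) * zeta p ^ k)"
      using cyc_int_ringE p_pos by metis
    have "y = Tr (\<beta> * (1 - zeta p) * a)"
      unfolding y x_Tr using a(1) beta_ring
      by (intro Tr_fixed_mult[symmetric] field cyc_int_ring_mult cyc_int_ring_diff) auto
    also have "\<beta> * (1 - zeta p) * a = (\<Sum>k<p. of_int (c k) * (\<beta> * zeta p ^ k))"
      by (simp add: mult.assoc c sum_distrib_left mult.left_commute)
    also have "Tr \<dots> = (\<Sum>k<p. of_int (c k) * Tr (\<beta> * zeta p ^ k))"
      by (subst Tr_sum) (auto simp: Tr_of_int_mult field beta_zeta cyc_int_ring_mult)
    also have "\<dots> \<in> I" by (intro I_sum I_mult Tr_in_I) auto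
    finally show "y \<in> I" .
  next
    fix y assume "y \<in> I"
    then obtain c :: "nat \<Rightarrow> int" where y: "y = (\<Sum>i<n. of_int (c i) * (\<sigma> ^^ i) x)"
      by (auto simp: I_def)
    \<comment> \<open>A telescoping product representing the ratio of
      \<open>(\<sigma> ^^ i) x\<close> to \<open>x\<close>.\<close>
    define u where "u i = (\<Prod>j<i. (\<sigma> ^^ j) (\<sigma> x / x))" for i
    have u_ring: "u i \<in> cyc_int_ring p" for i
      unfolding u_def by (intro cyc_int_ring_prod sigma_funpow_in_cyc_int_ring hyp)
    have sigma_x: "(\<sigma> ^^ i) x = x * u i" for i
    proof (induction i)
      case (Suc i)
      \<comment> \<open>This includes \<open>x = 0\<close>, where both sides are zero.\<close>
      have "\<sigma> x = x * (\<sigma> x / x)" using sigma_funpow_0[of 1] by auto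
      hence "(\<sigma> ^^ i) (\<sigma> x) = (\<sigma> ^^ i) x * (\<sigma> ^^ i) (\<sigma> x / x)"
        using sigma_funpow_mult[OF field[OF x_ring] field[OF hyp]] by simp
      thus ?case unfolding funpow_Suc_right o_apply by (simp add: Suc u_def mult.assoc)
    qed (simp add: u_def)
    show "y \<in> {x * a | a. a \<in> ring_of_integers_K n p r}"
    \<comment> \<open>For \<open>x = 0\<close> also \<open>y = 0\<close>, with witness 0; otherwise
      \<open>x\<close> can be cancelled to show that each \<open>u i\<close> lies in K.\<close>
    proof (cases "x = 0")
      case True
      have "0 \<in> ring_of_integers_K n p r"
        by (simp add: ring_of_integers_K_def fix_field_def field algebraic_int_if_in_cyc_int_ring[OF _ p_pos])
      with True show ?thesis by (force simp: y)
    next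
      case False
      have u_fixed: "(\<sigma> ^^ n) (u i) = u i" for i
      proof -
        \<comment> \<open>Powers of \<open>\<sigma>\<close> commute, so all conjugates of
          \<open>x\<close> are fixed by \<open>\<sigma> ^^ n\<close>, and hence so are their ratios
          to \<open>x\<close>.\<close>
        have "x * (\<sigma> ^^ n) (u i) = (\<sigma> ^^ n) ((\<sigma> ^^ i) x)"
          by (simp add: sigma_x[of i] sigma_funpow_mult field x_ring u_ring x_fixed)
        also have "\<dots> = (\<sigma> ^^ i) ((\<sigma> ^^ n) x)"
          by (metis add.commute comp_apply funpow_add)
        also have "\<dots> = x * u i" by (simp only: x_fixed sigma_x[of i])
        finally show ?thesis using False by simp
      qed
      define a where "a = (\<Sum>i<n. of_int (c i) * u i)"
      have a_ring: "a \<in> cyc_int_ring p"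
        unfolding a_def by (intro cyc_int_ring_sum cyc_int_ring_mult u_ring of_int_in_cyc_int_ring)
      have "(\<sigma> ^^ n) a = a"
        unfolding a_def
        by (subst sigma_funpow_sum) (simp_all add: sigma_funpow_mult field u_ring cyc_int_ring_mult u_fixed)
      hence "a \<in> ring_of_integers_K n p r"
        by (simp add: ring_of_integers_K_def fix_field_def field a_ring algebraic_int_if_in_cyc_int_ring[OF _ p_pos])
      moreover have "y = x * a"
        by (simp add: y a_def sigma_x sum_distrib_left mult.left_commute)
      ultimately show ?thesis by blast
    qed
  qed
qed

end
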